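(* If $x\in\widehat{\mathbb{R}}$ is a generalized real number, then $x=\sigma x+dx$ is the unique decomposition of $x$ as the sum of a real number and an infinitesimal (that is, $\sigma x$ is real, $dx$ is infinitesimal, $x=\sigma x+dx$, and if $x=\xi+\hat\varepsilon$ with $\xi\in\mathbb{R}$ and $\hat\varepsilon$ infinitesimal, then $\xi=\sigma x$ and $\hat\varepsilon=dx$).
   Context: $\widehat{\mathbb{R}}$ is the set of all convergent sequences of real numbers (its elements are called generalized real numbers); a real number $\xi$ is identified with the constant sequence $(\xi)$, so $\mathbb{R}\subseteq\widehat{\mathbb{R}}$. Addition on $\widehat{\mathbb{R}}$ is termwise. The shadow $\sigma x\in\mathbb{R}$ of $x$ is its limit. An infinitesimal is an $x\in\widehat{\mathbb{R}}$ with $\sigma x=0$. The differential $dx$ of $x$ is the unique infinitesimal $\hat\varepsilon(x)$ such that $x=\sigma x+\hat\varepsilon(x)$, i.e. $dx=x-\sigma x$. *)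

theory Defs
  imports Complex_Main
begin

text \<open>
  Generalized real numbers are convergent sequences themselves: two sequences
  with the same limit, or even differing in a single term, are distinct elements.
\<close>

typedef genreal = "{X :: nat \<Rightarrow> real. convergent X}"
  morphisms seq_of Abs_genreal
  by (auto intro: convergent_const)

setup_lifting type_definition_genreal

instantiation genreal :: ab_group_add
begin

lift_definition zero_genreal :: genreal is "\<lambda>n. 0"
  by (rule convergent_const)

lift_definition plus_genreal :: "genreal \<Rightarrow> genreal \<Rightarrow> genreal" is "\<lambda>X Y n. X n + Y n"
  by (rule convergent_add)

lift_definition minus_genreal :: "genreal \<Rightarrow> genreal \<Rightarrow> genreal" is "\<lambda>X Y n. X n - Y n"
  by (rule convergent_diff)

lift_definition uminus_genreal :: "genreal \<Rightarrow> genreal" is "\<lambda>X n. - X n"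
  by (simp add: convergent_minus_iff[symmetric])

instance
  by standard (transfer; simp add: algebra_simps)+

end

text \<open>The identification of a real number with a constant sequence.\<close>

lift_definition genreal_of_real :: "real \<Rightarrow> genreal" is "\<lambda>\<xi> n. \<xi>"
  by (rule convergent_const)

definition shadow :: "genreal \<Rightarrow> real" where
  "shadow x = lim (seq_of x)"

definition infinitesimal :: "genreal \<Rightarrow> bool" where
  "infinitesimal x \<longleftrightarrow> shadow x = 0"

text \<open>
  The differential is introduced by its characterizing property; that the
  description denotes, and that it equals \<open>x - genreal_of_real (shadow x)\<close>,
  is not built into the definition.
\<close>

definition differential :: "genreal \<Rightarrow> genreal" where
  "differential x = (THE e. infinitesimal e \<and> x = genreal_of_real (shadow x) + e)"

end

theory Submission
  imports Defs
begin

text \<open>Limits respect termwise sums and differences and fix constant sequences, so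
  \<open>shadow\<close> is additive and is a left inverse of \<open>genreal_of_real\<close>. Hence
  \<open>x - genreal_of_real (shadow x)\<close> has shadow 0, which gives existence. Taking shadows
  in a decomposition into a real and an infinitesimal recovers the real part, and cancellation then
  fixes the infinitesimal.\<close>

text \<open>The type admits only convergent sequences, so the \<open>lim\<close> in
  \<open>shadow\<close> is a genuine limit; the limit laws become available from here.\<close>

lemma seq_of_tendsto_shadow: "seq_of x \<longlonglongrightarrow> shadow x"
  using seq_of[of x] by (simp add: shadow_def convergent_LIMSEQ_iff)

lemma shadow_eqI: "seq_of x \<longlonglongrightarrow> l \<Longrightarrow> shadow x = l"
  by (simp add: shadow_def limI)

lemma shadow_add: "shadow (x + y) = shadow x + shadow y"
  by (rule shadow_eqI)
    (simp add: plus_genreal.rep_eq tendsto_add seq_of_tendsto_shadow)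

lemma shadow_diff: "shadow (x - y) = shadow x - shadow y"
  by (rule shadow_eqI)
    (simp add: minus_genreal.rep_eq tendsto_diff seq_of_tendsto_shadow)

lemma shadow_genreal_of_real: "shadow (genreal_of_real \<xi>) = \<xi>"
  by (rule shadow_eqI) (simp add: genreal_of_real.rep_eq)

text \<open>This shows that the \<open>THE\<close> description denotes: the difference is a witness
  because its shadow is \<open>shadow x - shadow x\<close>, and cancellation in the group makes it
  the only one.\<close>

lemma differential_eq: "differential x = x - genreal_of_real (shadow x)"
  unfolding differential_def
proof (rule the_equality)
  show "infinitesimal (x - genreal_of_real (shadow x)) \<and>
      x = genreal_of_real (shadow x) + (x - genreal_of_real (shadow x))"
    by (simp add: infinitesimal_def shadow_diff shadow_genreal_of_real)
next
  fix e
  assume "infinitesimal e \<and> x = genreal_of_real (shadow x) + e"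
  then show "e = x - genreal_of_real (shadow x)"
    by (metis add_diff_cancel_left')
qed

theorem proposition3p3:
  fixes x :: genreal
  shows "infinitesimal (differential x) \<and>
         x = genreal_of_real (shadow x) + differential x \<and>
         (\<forall>(\<xi>::real) (e::genreal).
            infinitesimal e \<and> x = genreal_of_real \<xi> + e \<longrightarrow>
              \<xi> = shadow x \<and> e = differential x)"
  \<comment> \<open>For uniqueness, the shadow of \<open>genreal_of_real \<xi> + e\<close>
    simplifies to \<open>\<xi> + 0\<close>.\<close>
  by (auto simp: differential_eq infinitesimal_def shadow_add shadow_diff shadow_genreal_of_real)

end
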